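(* Let $q$ be a prime power, $n \geq 1$ and $\Lambda$ integers with $q \geq \Lambda$, and let $\epsilon,\delta > 0$. Let $\gamma_1,\ldots,\gamma_\Lambda \in \mathbb{F}_q$ be distinct and for each $i$ let $c_i(T) \in \mathbb{F}_q[T]$ be the unique polynomial of degree $\Lambda - 1$ with $c_i(\gamma_i) = 1$ and $c_i(\gamma_j) = 0$ for $j \neq i$. Define $f_{\mathrm{DW}} : (\mathbb{F}_q^n)^\Lambda \times \mathbb{F}_q \to \mathbb{F}_q^n$ by $f_{\mathrm{DW}}((\mathbf{x}_1,\ldots,\mathbf{x}_\Lambda), u) = \sum_{i=1}^\Lambda c_i(u)\mathbf{x}_i$. Let $\mathsf{A}$ be a somewhere-random source taking values in $(\mathbb{F}_q^n)^\Lambda$, let $\mathsf{B}$ be uniform on $\mathbb{F}_q$ and independent of $\mathsf{A}$, and let $\mathsf{C} = f_{\mathrm{DW}}(\mathsf{A},\mathsf{B})$. If $$q \geq \left(\frac{2\Lambda}{\epsilon}\right)^{1/\delta},$$ then $\mathsf{C}$ is $\epsilon$-close to having min-entropy $(1-\delta)\cdot n \cdot \log_2 q$.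
   Context: A somewhere-random source on $(\mathbb{F}_q^n)^\Lambda$ is a convex combination of random variables $(\mathsf{A}_1,\ldots,\mathsf{A}_\Lambda)$ on $(\mathbb{F}_q^n)^\Lambda$ for which some coordinate $\mathsf{A}_{i_0}$ is uniformly distributed on $\mathbb{F}_q^n$. The statistical distance between random variables $\mathsf{X},\mathsf{Y}$ on a finite set $\Omega$ is $\max_{T\subseteq\Omega}|\Pr[\mathsf{X}\in T]-\Pr[\mathsf{Y}\in T]|$; $\epsilon$-close means distance at most $\epsilon$. Min-entropy: $H_\infty(\mathsf{X}) = \min_{x\in\mathrm{supp}(\mathsf{X})}\log_2(1/\Pr[\mathsf{X}=x])$; $\mathsf{X}$ is $\epsilon$-close to having min-entropy $m$ if it is $\epsilon$-close to some random variable of min-entropy $m$.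
   Formalization: "Having min-entropy m" is read as min-entropy at least m, the usual convention; with exact equality the claim fails, e.g. for δ = 1, Λ = 1, q = 4, ε = 1/2 and A uniform, or whenever δ > 1. *)

theory Defs
  imports "HOL-Probability.Probability" "HOL-Computational_Algebra.Polynomial"
begin

text \<open>
  A finite field is a type of class \<open>{field, finite}\<close>, with \<open>q = CARD('a)\<close>. The space
  \<open>F_q^n\<close> is \<open>'a ^ 'n\<close> with \<open>n = CARD('n)\<close>, and its \<open>\<Lambda>\<close>-fold power is \<open>('a ^ 'n) ^ 'l\<close>
  with \<open>\<Lambda> = CARD('l)\<close>. A random variable on a finite set is given by its distribution, a pmf;
  the joint distribution of independent random variables is \<open>pair_pmf\<close>.
\<close>

definition stat_dist :: "'b::finite pmf \<Rightarrow> 'b pmf \<Rightarrow> real" where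
  "stat_dist X Y = Max (range (\<lambda>T. \<bar>measure_pmf.prob X T - measure_pmf.prob Y T\<bar>))"

definition eps_close :: "real \<Rightarrow> 'b::finite pmf \<Rightarrow> 'b pmf \<Rightarrow> bool" where
  "eps_close \<epsilon> X Y \<longleftrightarrow> stat_dist X Y \<le> \<epsilon>"

definition min_entropy :: "'b::finite pmf \<Rightarrow> real" where
  "min_entropy X = Min ((\<lambda>x. log 2 (1 / pmf X x)) ` set_pmf X)"

text \<open>
  As usual for randomness extractors and mergers, having min-entropy \<open>m\<close> means having
  min-entropy at least \<open>m\<close>. Equality would be too strong: the uniform distribution on \<open>F_q^n\<close>
  is far from every distribution whose min-entropy is exactly \<open>0\<close>, and no distribution has
  negative min-entropy.
\<close>

definition close_to_min_entropy :: "real \<Rightarrow> 'b::finite pmf \<Rightarrow> real \<Rightarrow> bool" where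
  "close_to_min_entropy \<epsilon> X m \<longleftrightarrow> (\<exists>Z. min_entropy Z \<ge> m \<and> eps_close \<epsilon> X Z)"

definition has_uniform_coordinate :: "(('a::finite ^ 'n::finite) ^ 'l::finite) pmf \<Rightarrow> bool" where
  "has_uniform_coordinate D \<longleftrightarrow> (\<exists>i\<^sub>0. map_pmf (\<lambda>x. x $ i\<^sub>0) D = pmf_of_set UNIV)"

definition somewhere_random :: "(('a::finite ^ 'n::finite) ^ 'l::finite) pmf \<Rightarrow> bool" where
  "somewhere_random A \<longleftrightarrow>
     (\<exists>(N::nat) (w :: nat \<Rightarrow> real) D.
        (\<forall>k<N. 0 \<le> w k) \<and> (\<Sum>k<N. w k) = 1 \<and>
        (\<forall>k<N. has_uniform_coordinate (D k)) \<and>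
        (\<forall>x. pmf A x = (\<Sum>k<N. w k * pmf (D k) x)))"

definition is_interp_basis :: "('l::finite \<Rightarrow> 'a::field) \<Rightarrow> ('l \<Rightarrow> 'a poly) \<Rightarrow> bool" where
  "is_interp_basis \<gamma> c \<longleftrightarrow>
     (\<forall>i. degree (c i) = CARD('l) - 1 \<and> poly (c i) (\<gamma> i) = 1 \<and>
          (\<forall>j. j \<noteq> i \<longrightarrow> poly (c i) (\<gamma> j) = 0))"

definition f_DW :: "('l::finite \<Rightarrow> 'a::field poly) \<Rightarrow> (('a ^ 'n::finite) ^ 'l) \<times> 'a \<Rightarrow> 'a ^ 'n" where
  "f_DW c = (\<lambda>(x, u). \<Sum>i\<in>UNIV. poly (c i) u *s (x $ i))"

lemma ex1_interp_basis:
  fixes \<gamma> :: "'l::finite \<Rightarrow> 'a::field"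
  assumes inj: "inj \<gamma>"
  shows "\<exists>!c. is_interp_basis \<gamma> c"
proof (rule ex_ex1I)
  define p where "p i = (\<Prod>j\<in>UNIV-{i}. [:- \<gamma> j, 1:])" for i
  have p_i: "poly (p i) (\<gamma> i) \<noteq> 0" for i
    using inj by (auto simp: p_def poly_prod inj_eq)
  have p_j: "poly (p i) (\<gamma> j) = 0" if "j \<noteq> i" for i j
    using that by (auto simp: p_def poly_prod intro!: prod_zero)
  have deg: "degree (p i) = CARD('l) - 1" for i
    unfolding p_def by (subst degree_prod_eq_sum_degree) (auto simp: card_Diff_singleton)
  have "is_interp_basis \<gamma> (\<lambda>i. smult (1 / poly (p i) (\<gamma> i)) (p i))"
    using p_i p_j deg by (auto simp: is_interp_basis_def)
  then show "\<exists>c. is_interp_basis \<gamma> c" by blast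
next
  fix c d assume c: "is_interp_basis \<gamma> c" and d: "is_interp_basis \<gamma> d"
  show "c = d"
  proof
    fix i
    show "c i = d i"
    proof (rule ccontr)
      assume "c i \<noteq> d i"
      then have nz: "c i - d i \<noteq> 0" by simp
      have eq: "poly (c i) (\<gamma> j) = poly (d i) (\<gamma> j)" for j
        using c d unfolding is_interp_basis_def by (cases "j = i") simp_all
      have "CARD('l) = card (range \<gamma>)"
        using inj by (simp add: card_image)
      also have "\<dots> \<le> card {x. poly (c i - d i) x = 0}"
        by (rule card_mono[OF poly_roots_finite[OF nz]]) (auto simp: eq)
      also have "\<dots> \<le> degree (c i - d i)"
        by (rule card_poly_roots_bound[OF nz])
      also have "\<dots> \<le> CARD('l) - 1"
        using c d by (intro degree_diff_le) (simp_all add: is_interp_basis_def)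
      finally show False
        using zero_less_card_finite[where 'a = 'l] by linarith
    qed
  qed
qed

end

theory Submission
  imports Defs
begin

text \<open>
  The argument is the method of multiplicities of Dvir, Kopparty, Saraf and Sudan. Put
  \<open>d = q^(1-\<delta>)\<close>. If \<open>C\<close> is not close to min-entropy \<open>(1-\<delta>) n log q\<close>, then the set \<open>S\<close> of
  points of mass above \<open>d^(-n)\<close> has fewer than \<open>d^n\<close> elements but mass more than \<open>\<epsilon>\<close>. Let \<open>x\<close> be
  the uniform coordinate; choosing the remaining coordinates as a function of \<open>x\<close> to maximise the
  hits, one gets for each \<open>x\<close> a curve of degree \<open>\<Lambda>-1\<close> through \<open>x\<close> meeting \<open>S\<close> for \<open>g(x)\<close>
  parameters, with \<open>g(x)\<close> of average more than \<open>\<epsilon> q\<close>.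

  For an integer \<open>r \<ge> d\<close> and large \<open>m\<close>, counting coefficients gives a nonzero polynomial \<open>P\<close> of
  degree about \<open>r m\<close> that vanishes to order \<open>m\<close> on \<open>S\<close>. Let \<open>\<mu>(x)\<close> be its vanishing order at
  \<open>x\<close>. Some Hasse derivative of order \<open>\<mu>(x)\<close> is nonzero at \<open>x\<close>, and its restriction to the curve
  has \<open>g(x)\<close> zeros of order \<open>m - \<mu>(x)\<close>, so \<open>m g(x) \<le> r m (\<Lambda>-1) + q \<mu>(x)\<close> up to lower order
  terms. The average of \<open>\<mu>\<close> is at most \<open>r m / q\<close> by the Schwartz-Zippel lemma with
  multiplicities, hence \<open>g\<close> has average at most \<open>r \<Lambda>\<close>. The factor \<open>2\<close> in the hypothesis on \<open>q\<close>
  pays for rounding \<open>d\<close> up to \<open>r\<close>.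
\<close>

section \<open>Polynomials in several variables and their Hasse derivatives\<close>

text \<open>
  A polynomial in the variables \<open>'n\<close> is its coefficient function on exponent vectors, supported in
  \<open>exps d\<close> where \<open>d\<close> bounds the total degree.
\<close>

definition exps :: "nat \<Rightarrow> ('n::finite \<Rightarrow> nat) set" where
  "exps d = {e. sum e UNIV \<le> d}"

text \<open>Binomial coefficients replace iterated derivatives, so that Taylor's formula needs no
  division by factorials and holds in positive characteristic. For \<open>e < j\<close> the
  truncated exponent is harmless, since the binomial coefficient is \<open>0\<close>.\<close>

definition hasse_monom :: "nat \<Rightarrow> nat \<Rightarrow> 'r::comm_ring_1 \<Rightarrow> 'r" where
  "hasse_monom e j x = of_nat (e choose j) * x ^ (e - j)"

text \<open>Over a general commutative ring, \<open>x\<close> can be a point of the field or, once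
  the coefficients are lifted to constants, a tuple of univariate polynomials, that is, a
  curve.\<close>

definition hasse ::
    "nat \<Rightarrow> (('n::finite \<Rightarrow> nat) \<Rightarrow> 'r::comm_ring_1) \<Rightarrow> ('n \<Rightarrow> nat) \<Rightarrow> ('n \<Rightarrow> 'r) \<Rightarrow> 'r" where
  "hasse d p j x = (\<Sum>e\<in>exps d. p e * (\<Prod>i\<in>UNIV. hasse_monom (e i) (j i) (x i)))"

lemma exps_le:
  assumes "e \<in> exps d"
  shows "e i \<le> d"
proof -
  have "e i \<le> sum e UNIV" by (rule member_le_sum) auto
  then show ?thesis using assms by (simp add: exps_def)
qed

lemma finite_exps [simp]: "finite (exps d :: ('n::finite \<Rightarrow> nat) set)"
proof (rule finite_subset)
  show "(exps d :: ('n \<Rightarrow> nat) set) \<subseteq> UNIV \<rightarrow>\<^sub>E {..d}"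
    by (auto simp: PiE_def exps_le)
qed (auto intro: finite_PiE)

lemma hasse_monom_eq_0: "e < j \<Longrightarrow> hasse_monom e j x = 0"
  by (simp add: hasse_monom_def binomial_eq_0)

text \<open>The binomial theorem with \<open>(e choose j) * (e - j choose k) = (e choose (j + k)) *
  (j + k choose j)\<close>. Summing up to \<open>d\<close> instead of \<open>e - j\<close> gives all
  variables the same range, so that a product of such sums can be expanded.\<close>

lemma hasse_monom_add:
  fixes a b :: "'r::comm_ring_1"
  assumes "e \<le> d"
  shows "hasse_monom e j (a + b) =
    (\<Sum>k\<le>d. hasse_monom e (j + k) a * (of_nat (j + k choose j) * b ^ k))"
proof (cases "j \<le> e")
  case True
  have "hasse_monom e j (a + b) =
      (\<Sum>k\<le>e - j. of_nat ((e choose j) * (e - j choose k)) * a ^ (e - j - k) * b ^ k)"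
    by (simp add: hasse_monom_def add.commute[of a b] binomial_ring sum_distrib_left mult_ac)
  also have "\<dots> = (\<Sum>k\<le>e - j. hasse_monom e (j + k) a * (of_nat (j + k choose j) * b ^ k))"
  proof (rule sum.cong)
    fix k assume "k \<in> {..e - j}"
    then have "(e choose j) * (e - j choose k) = (e choose (j + k)) * (j + k choose j)"
      using True choose_mult[of j "j + k" e] by simp
    then show "of_nat ((e choose j) * (e - j choose k)) * a ^ (e - j - k) * b ^ k =
        hasse_monom e (j + k) a * (of_nat (j + k choose j) * b ^ k)"
      by (simp add: hasse_monom_def mult_ac)
  qed simp
  also have "\<dots> = (\<Sum>k\<le>d. hasse_monom e (j + k) a * (of_nat (j + k choose j) * b ^ k))"
    proof (rule sum.mono_neutral_left)
    show "\<forall>k\<in>{..d} - {..e - j}. hasse_monom e (j + k) a * (of_nat (j + k choose j) * b ^ k) = 0"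
    proof
      fix k assume "k \<in> {..d} - {..e - j}"
      then have "e < j + k" using True by auto
      then show "hasse_monom e (j + k) a * (of_nat (j + k choose j) * b ^ k) = 0"
        by (simp add: hasse_monom_eq_0)
    qed
  qed (use assms in auto)
  finally show ?thesis .
qed (simp add: hasse_monom_eq_0)

text \<open>Taylor's formula for a Hasse derivative: expand each variable and multiply out.\<close>

lemma hasse_add:
  "hasse d p j (\<lambda>i. a i + b i) =
    (\<Sum>k\<in>UNIV \<rightarrow>\<^sub>E {..d}. hasse d p (\<lambda>i. j i + k i) a *
       (\<Prod>i\<in>UNIV. of_nat (j i + k i choose j i) * b i ^ k i))"
proof -
  have "hasse d p j (\<lambda>i. a i + b i) = (\<Sum>e\<in>exps d. p e *
      (\<Prod>i\<in>UNIV. \<Sum>k\<le>d. hasse_monom (e i) (j i + k) (a i) *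
         (of_nat (j i + k choose j i) * b i ^ k)))"
    unfolding hasse_def by (intro sum.cong prod.cong arg_cong2[where f = "(*)"] refl hasse_monom_add exps_le)
  also have "\<dots> = (\<Sum>e\<in>exps d. \<Sum>k\<in>UNIV \<rightarrow>\<^sub>E {..d}. p e *
      (\<Prod>i\<in>UNIV. hasse_monom (e i) (j i + k i) (a i)) *
      (\<Prod>i\<in>UNIV. of_nat (j i + k i choose j i) * b i ^ k i))"
    by (subst prod_sum_PiE) (auto simp: sum_distrib_left prod.distrib mult_ac)
  also have "\<dots> = (\<Sum>k\<in>UNIV \<rightarrow>\<^sub>E {..d}. hasse d p (\<lambda>i. j i + k i) a *
      (\<Prod>i\<in>UNIV. of_nat (j i + k i choose j i) * b i ^ k i))"
    by (subst sum.swap) (simp add: hasse_def sum_distrib_right)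
  finally show ?thesis .
qed

lemma const_poly_prod: "[:\<Prod>i\<in>A. f i:] = (\<Prod>i\<in>A. [:f i:])"
  for f :: "'b \<Rightarrow> 'r::comm_ring_1"
proof (induction A rule: infinite_finite_induct)
  case (insert i A)
  have "[:\<Prod>i\<in>insert i A. f i:] = [:f i:] * [:\<Prod>i\<in>A. f i:]" using insert.hyps by simp
  then show ?case by (simp only: insert.IH prod.insert[OF insert.hyps])
qed (simp_all add: one_pCons)

lemma const_poly_sum: "[:\<Sum>i\<in>A. f i:] = (\<Sum>i\<in>A. [:f i:])"
  for f :: "'b \<Rightarrow> 'r::comm_ring_1"
proof (induction A rule: infinite_finite_induct)
  case (insert i A)
  have "[:\<Sum>i\<in>insert i A. f i:] = [:f i:] + [:\<Sum>i\<in>A. f i:]" using insert.hyps by simp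
  then show ?case by (simp only: insert.IH sum.insert[OF insert.hyps])
qed simp_all

lemma hasse_monom_const: "hasse_monom e j [:a:] = [:hasse_monom e j a:]"
  by (simp add: hasse_monom_def poly_const_pow of_nat_poly)

lemma hasse_const:
  fixes a :: "'n::finite \<Rightarrow> 'r::comm_ring_1"
  shows "hasse d (\<lambda>e. [:p e:]) j (\<lambda>i. [:a i:]) = [:hasse d p j a:]"
proof -
  have "[:p e * (\<Prod>i\<in>UNIV. f i):] = [:p e:] * (\<Prod>i\<in>UNIV. [:f i:])" for e and f :: "'n \<Rightarrow> 'r"
    by (simp flip: const_poly_prod)
  then show ?thesis
    by (simp only: hasse_def const_poly_sum hasse_monom_const)
qed

section \<open>Restriction to curves\<close>

lemma poly_hasse: "poly (hasse d (\<lambda>e. [:p e:]) j h) t = hasse d p j (\<lambda>i. poly (h i) t)"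
  by (simp add: hasse_def poly_sum poly_prod hasse_monom_def)

text \<open>Expand around the constant point \<open>h(u)\<close>; each increment is divisible by
  \<open>T - u\<close>. A Taylor term of order \<open>k\<close> vanishes by hypothesis if
  \<open>|j| + |k| < m\<close>, and otherwise contains \<open>(T - u)^|k|\<close> with
  \<open>|k| \<ge> m - |j|\<close>.\<close>

lemma linear_power_dvd_hasse:
  fixes p :: "('n::finite \<Rightarrow> nat) \<Rightarrow> 'a::field"
  assumes "\<And>j. sum j UNIV < m \<Longrightarrow> hasse d p j (\<lambda>i. poly (h i) u) = 0"
  shows "[:- u, 1:] ^ (m - sum j UNIV) dvd hasse d (\<lambda>e. [:p e:]) j h"
proof -
  let ?l = "[:- u, 1:]"
  have "\<exists>s. h i = [:poly (h i) u:] + ?l * s" for i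
  proof -
    have "?l dvd h i - [:poly (h i) u:]"
      by (simp flip: poly_eq_0_iff_dvd)
    then obtain s where "h i - [:poly (h i) u:] = ?l * s" by (auto elim: dvdE)
    then show ?thesis by (metis add_diff_cancel_left' diff_add_cancel add.commute)
  qed
  then obtain s where s: "\<And>i. h i = [:poly (h i) u:] + ?l * s i" by metis
  have "?l ^ (m - sum j UNIV) dvd hasse d (\<lambda>e. [:p e:]) (\<lambda>i. j i + k i) (\<lambda>i. [:poly (h i) u:]) *
     (\<Prod>i\<in>UNIV. of_nat (j i + k i choose j i) * (?l * s i) ^ k i)" for k :: "'n \<Rightarrow> nat"
  proof (cases "sum j UNIV + sum k UNIV < m")
    case True
    then have "hasse d p (\<lambda>i. j i + k i) (\<lambda>i. poly (h i) u) = 0"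
      by (intro assms) (simp add: sum.distrib)
    then show ?thesis by (simp add: hasse_const)
  next
    case False
    have "(\<Prod>i\<in>UNIV. of_nat (j i + k i choose j i) * (?l * s i) ^ k i) =
        ?l ^ sum k UNIV * (\<Prod>i\<in>UNIV. of_nat (j i + k i choose j i) * s i ^ k i)"
      by (simp only: power_sum power_mult_distrib prod.distrib mult_ac)
    moreover have "?l ^ (m - sum j UNIV) dvd ?l ^ sum k UNIV"
      using False by (intro le_imp_power_dvd) simp
    ultimately show ?thesis by (simp only: dvd_mult dvd_mult2)
  qed
  then have "?l ^ (m - sum j UNIV) dvd hasse d (\<lambda>e. [:p e:]) j (\<lambda>i. [:poly (h i) u:] + ?l * s i)"
    unfolding hasse_add by (intro dvd_sum)
  then show ?thesis using s by (simp flip: s)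
qed

lemma sum_root_multiplicities_le_degree:
  fixes g :: "'a::{field,finite} poly"
  assumes "g \<noteq> 0" and "\<And>u. [:- u, 1:] ^ k u dvd g"
  shows "(\<Sum>u\<in>UNIV. k u) \<le> degree g"
proof -
  have "k u \<le> order u g" for u
    using assms by (simp add: order_divides)
  then have "(\<Sum>u\<in>UNIV. k u) \<le> (\<Sum>u\<in>UNIV. order u g)"
    by (intro sum_mono)
  also have "\<dots> = (\<Sum>u | poly g u = 0. order u g)"
    using assms(1) by (intro sum.mono_neutral_right) (auto simp: order_root)
  also have "\<dots> \<le> degree g"
    using assms(1) by (rule sum_order_le_degree)
  finally show ?thesis .
qed

section \<open>Vanishing orders\<close>

text \<open>By maximality of the total degree, any other monomial of \<open>p\<close> has a smaller
  exponent than \<open>e\<close> in some variable and is killed there.\<close>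

lemma hasse_top:
  fixes p :: "('n::finite \<Rightarrow> nat) \<Rightarrow> 'r::comm_ring_1"
  assumes "e \<in> exps d" and "\<And>e'. p e' \<noteq> 0 \<Longrightarrow> sum e' UNIV \<le> sum e UNIV"
  shows "hasse d p e x = p e"
proof -
  have "p e' * (\<Prod>i\<in>UNIV. hasse_monom (e' i) (e i) (x i)) = (if e' = e then p e else 0)" for e'
  proof (cases "p e' = 0 \<or> e' = e")
    case True
    then show ?thesis by (auto simp: hasse_monom_def)
  next
    case False
    have "\<exists>i. e' i < e i"
    proof (rule ccontr)
      assume "\<not> ?thesis"
      then have le: "\<And>i. e i \<le> e' i" by (simp add: not_less)
      then obtain i where "e i < e' i" using False by (metis ext le_neq_implies_less)
      then have "sum e UNIV < sum e' UNIV" using le by (intro sum_strict_mono_ex1) auto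
      then show False using assms(2)[of e'] False by simp
    qed
    then obtain i where "e' i < e i" by blast
    then have "(\<Prod>i\<in>UNIV. hasse_monom (e' i) (e i) (x i)) = 0"
      by (intro prod_zero bexI[of _ i]) (auto simp: hasse_monom_eq_0)
    then show ?thesis using False by simp
  qed
  then show ?thesis using assms(1) by (simp add: hasse_def)
qed

lemma ex_hasse_nonzero:
  fixes p :: "('n::finite \<Rightarrow> nat) \<Rightarrow> 'r::comm_ring_1"
  assumes "p e0 \<noteq> 0" and "\<And>e. p e \<noteq> 0 \<Longrightarrow> e \<in> exps d"
  shows "\<exists>j. hasse d p j x \<noteq> 0"
proof -
  obtain e where "p e \<noteq> 0" "\<And>e'. p e' \<noteq> 0 \<Longrightarrow> sum e' UNIV \<le> sum e UNIV"
    using ex_has_greatest_nat[of "\<lambda>e. p e \<noteq> 0" e0 "\<lambda>e. sum e UNIV" "Suc d"] assms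
    by (auto simp: exps_def less_Suc_eq_le)
  then show ?thesis using hasse_top[of e d p x] assms(2) by (intro exI[of _ e]) auto
qed

text \<open>For nonzero \<open>p\<close> supported in \<open>exps d\<close>, the minimum exists by
  \<open>ex_hasse_nonzero\<close>.\<close>

definition vanish_order :: "nat \<Rightarrow> (('n::finite \<Rightarrow> nat) \<Rightarrow> 'r::comm_ring_1) \<Rightarrow> ('n \<Rightarrow> 'r) \<Rightarrow> nat" where
  "vanish_order d p x = (LEAST w. \<exists>j. sum j UNIV = w \<and> hasse d p j x \<noteq> 0)"

lemma hasse_eq_0_if_less_vanish_order: "sum j UNIV < vanish_order d p x \<Longrightarrow> hasse d p j x = 0"
  unfolding vanish_order_def using not_less_Least by blast

lemma vanish_order_le: "hasse d p j x \<noteq> 0 \<Longrightarrow> vanish_order d p x \<le> sum j UNIV"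
  unfolding vanish_order_def by (rule Least_le) blast

lemma ex_hasse_vanish_order_nonzero:
  assumes "p e0 \<noteq> 0" and "\<And>e. p e \<noteq> 0 \<Longrightarrow> e \<in> exps d"
  obtains j where "sum j UNIV = vanish_order d p x" and "hasse d p j x \<noteq> 0"
proof -
  have "\<exists>w. \<exists>j. sum j UNIV = w \<and> hasse d p j x \<noteq> 0"
    using ex_hasse_nonzero[of p e0 d x] assms by blast
  from LeastI_ex[OF this] that show thesis unfolding vanish_order_def by blast
qed

section \<open>The Schwartz-Zippel lemma with multiplicities\<close>

text \<open>
  Here \<open>pK\<close> is the coefficient of the top power \<open>K\<close> of the variable \<open>v\<close>. A Hasse derivative witnessing
  its vanishing order at \<open>x\<close>, applied to \<open>p\<close>, is a nonzero polynomial of degree \<open>K\<close> on the line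
  through \<open>x\<close> in direction \<open>v\<close>.
\<close>

lemma vanish_order_fiber_le:
  fixes p :: "('n::finite \<Rightarrow> nat) \<Rightarrow> 'a::{field,finite}"
  assumes p: "\<And>e. p e \<noteq> 0 \<Longrightarrow> e \<in> exps d"
    and K: "\<And>e. p e \<noteq> 0 \<Longrightarrow> e v \<le> K"
    and pK_def: "pK = (\<lambda>e. if e v = 0 then p (e(v := K)) else 0)"
    and pK: "pK e0 \<noteq> 0"
  shows "(\<Sum>t\<in>UNIV. vanish_order d p (x(v := t))) \<le> CARD('a) * vanish_order d pK x + K"
proof -
  have supp: "e \<in> exps d" if "pK e \<noteq> 0" for e
  proof -
    have "e v = 0" "p (e(v := K)) \<noteq> 0" using that by (auto simp: pK_def split: if_splits)
    moreover have "sum e UNIV \<le> sum (e(v := K)) UNIV"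
      by (intro sum_mono) (use \<open>e v = 0\<close> in auto)
    ultimately show ?thesis using p[of "e(v := K)"] by (simp add: exps_def)
  qed
  obtain j where j: "sum j UNIV = vanish_order d pK x" "hasse d pK j x \<noteq> 0"
    using ex_hasse_vanish_order_nonzero[of pK e0 d x] pK supp by blast
  \<comment> \<open>As \<open>pK\<close> does not involve \<open>v\<close>, the witness does not
    differentiate in \<open>v\<close>; applied to \<open>p\<close>, it therefore keeps the powers of
    \<open>v\<close>.\<close>
  have jv: "j v = 0"
  proof (rule ccontr)
    assume "j v \<noteq> 0"
    then have "hasse_monom (e v) (j v) (x v) = 0" if "e v = 0" for e
      using that by (simp add: hasse_monom_eq_0)
    then have "(\<Prod>i\<in>UNIV. hasse_monom (e i) (j i) (x i)) = 0" if "e v = 0" for e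
      using that by (intro prod_zero bexI[of _ v]) auto
    then have "pK e * (\<Prod>i\<in>UNIV. hasse_monom (e i) (j i) (x i)) = 0" for e
      by (cases "e v = 0") (auto simp: pK_def)
    then show False using j(2) unfolding hasse_def by (metis (no_types, lifting) sum.neutral)
  qed
  define h where "h = (\<lambda>i. if i = v then [:0, 1:] else [:x i:])"
  define g where "g = hasse d (\<lambda>e. [:p e:]) j h"
  define c where "c e = p e * (\<Prod>i\<in>UNIV - {v}. hasse_monom (e i) (j i) (x i))" for e
  have g_eq: "g = (\<Sum>e\<in>exps d. monom (c e) (e v))"
  proof -
    have "[:p e:] * (\<Prod>i\<in>UNIV. hasse_monom (e i) (j i) (h i)) = monom (c e) (e v)" for e
    proof -
      have "(\<Prod>i\<in>UNIV. hasse_monom (e i) (j i) (h i)) = hasse_monom (e v) (j v) (h v) *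
          (\<Prod>i\<in>UNIV - {v}. hasse_monom (e i) (j i) (h i))"
        by (rule prod.remove) auto
      also have "hasse_monom (e v) (j v) (h v) = monom 1 (e v)"
        by (simp add: jv h_def hasse_monom_def monom_altdef)
      also have "(\<Prod>i\<in>UNIV - {v}. hasse_monom (e i) (j i) (h i)) =
          [:\<Prod>i\<in>UNIV - {v}. hasse_monom (e i) (j i) (x i):]"
        unfolding const_poly_prod by (intro prod.cong) (auto simp: h_def hasse_monom_const)
      finally show ?thesis by (simp add: c_def smult_monom mult_ac)
    qed
    then show ?thesis by (simp add: g_def hasse_def)
  qed
  have "coeff g K = (\<Sum>e | e \<in> exps d \<and> e v = K. c e)"
    by (simp add: g_eq coeff_sum sum.inter_filter)
  \<comment> \<open>Erasing the exponent of \<open>v\<close> matches the terms. Restoring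
    \<open>K\<close> may lead out of \<open>exps d\<close>, so the bijection is only between terms
    with nonzero coefficients.\<close>
  also have "\<dots> = hasse d pK j x"
    unfolding hasse_def
  proof (rule sum.reindex_bij_witness_not_neutral
      [where S' = "{e \<in> exps d. e v = K \<and> p e = 0}" and T' = "{e \<in> exps d. pK e = 0}"
         and i = "\<lambda>e. e(v := K)" and j = "\<lambda>e. e(v := 0)"], goal_cases)
    case (3 e)
    then show ?case by auto
  next
    case (4 e)
    then have "pK (e(v := 0)) \<noteq> 0" by (auto simp: pK_def)
    then show ?case using supp by auto
  next
    case (5 e)
    then show ?case by (auto simp: pK_def split: if_splits)
  next
    case (6 e)
    then have "p (e(v := K)) \<noteq> 0" by (auto simp: pK_def split: if_splits)
    then show ?case using p by auto
  next
    case (9 e)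
    have "(\<Prod>i\<in>UNIV. hasse_monom ((e(v := 0)) i) (j i) (x i)) =
        hasse_monom ((e(v := 0)) v) (j v) (x v) *
        (\<Prod>i\<in>UNIV - {v}. hasse_monom ((e(v := 0)) i) (j i) (x i))"
      by (rule prod.remove) auto
    also have "\<dots> = (\<Prod>i\<in>UNIV - {v}. hasse_monom (e i) (j i) (x i))"
      by (simp add: jv hasse_monom_def)
    finally show ?case using 9 by (auto simp: c_def pK_def)
  qed (auto simp: c_def)
  finally have "g \<noteq> 0" using j(2) by auto
  have "degree g \<le> K"
    unfolding g_eq
  proof (rule degree_sum_le)
    fix e
    show "degree (monom (c e) (e v)) \<le> K"
      using K[of e] by (cases "p e = 0") (auto simp: c_def intro: order_trans[OF degree_monom_le])
  qed simp
  \<comment> \<open>A derivative of order \<open>|j|\<close> lowers the vanishing order by at most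
    \<open>|j|\<close>, which is the vanishing order of \<open>pK\<close> at
    \<open>x\<close>.\<close>
  have "(\<Sum>t\<in>UNIV. vanish_order d p (x(v := t)) - vanish_order d pK x) \<le> degree g"
  proof (rule sum_root_multiplicities_le_degree[OF \<open>g \<noteq> 0\<close>])
    fix t
    have "(\<lambda>i. poly (h i) t) = x(v := t)" by (auto simp: h_def)
    then show "[:- t, 1:] ^ (vanish_order d p (x(v := t)) - vanish_order d pK x) dvd g"
      unfolding g_def j(1)[symmetric]
      by (intro linear_power_dvd_hasse) (auto intro: hasse_eq_0_if_less_vanish_order)
  qed
  then have "(\<Sum>t\<in>UNIV. vanish_order d p (x(v := t)) - vanish_order d pK x) \<le> K"
    using \<open>degree g \<le> K\<close> by simp
  moreover have "(\<Sum>t\<in>UNIV. vanish_order d p (x(v := t))) \<le>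
      (\<Sum>t\<in>UNIV. vanish_order d pK x + (vanish_order d p (x(v := t)) - vanish_order d pK x))"
    by (intro sum_mono) simp
  ultimately show ?thesis by (simp add: sum.distrib)
qed

text \<open>Turns a sum over lines in direction \<open>v\<close> into a sum over points: exchanging
  \<open>t\<close> with \<open>x v\<close> is an involution on the pairs.\<close>

lemma sum_fun_upd_UNIV:
  fixes F :: "('n::finite \<Rightarrow> 'a::finite) \<Rightarrow> nat"
  shows "(\<Sum>x\<in>UNIV. \<Sum>t\<in>UNIV. F (x(v := t))) = CARD('a) * (\<Sum>x\<in>UNIV. F x)"
proof -
  have "(\<Sum>x\<in>UNIV. \<Sum>t\<in>UNIV. F (x(v := t))) =
      (\<Sum>(x, t)\<in>UNIV \<times> UNIV. F (x(v := t)))"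
    by (simp add: sum.cartesian_product)
  also have "\<dots> = (\<Sum>(x, s)\<in>UNIV \<times> (UNIV :: 'a set). F x)"
    by (rule sum.reindex_bij_witness
        [where i = "\<lambda>(x, t). (x(v := t), x v)" and j = "\<lambda>(x, t). (x(v := t), x v)"]) auto
  also have "\<dots> = CARD('a) * (\<Sum>x\<in>UNIV. F x)"
    by (simp add: sum_distrib_left del: UNIV_Times_UNIV flip: sum.cartesian_product)
  finally show ?thesis .
qed

text \<open>
  The induction is over the set \<open>V\<close> of variables that occur in \<open>p\<close>; the points always range over the
  whole space, which avoids relating spaces of different dimension.
\<close>

lemma schwartz_zippel_vanish_order_aux:
  fixes p :: "('n::finite \<Rightarrow> nat) \<Rightarrow> 'a::{field,finite}"
  assumes "finite V"
    and "\<And>e i. p e \<noteq> 0 \<Longrightarrow> i \<notin> V \<Longrightarrow> e i = 0"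
    and "\<And>e. p e \<noteq> 0 \<Longrightarrow> sum e UNIV \<le> D"
    and "D \<le> d" and "p e0 \<noteq> 0"
  shows "CARD('a) * (\<Sum>x\<in>UNIV. vanish_order d p x) \<le> D * CARD('a) ^ CARD('n)"
  using assms
proof (induction V arbitrary: p D e0 rule: finite_induct)
  case empty
  have "e = (\<lambda>_. 0)" if "p e \<noteq> 0" for e
    using empty.prems(1)[OF that] by auto
  then have "hasse d p (\<lambda>_. 0) x \<noteq> 0" for x
    using empty.prems(4) hasse_top[of "\<lambda>_. 0" d p x] by (force simp: exps_def)
  then have "vanish_order d p x = 0" for x
    using vanish_order_le[of d p "\<lambda>_. 0" x] by simp
  then show ?case by simp
next
  case (insert v V)
  have "e v \<le> D" if "p e \<noteq> 0" for e
    using insert.prems(2)[OF that] exps_le[of e D] by (simp add: exps_def)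
  then obtain e1 where e1: "p e1 \<noteq> 0" "\<And>e'. p e' \<noteq> 0 \<Longrightarrow> e' v \<le> e1 v"
    using ex_has_greatest_nat[of "\<lambda>e. p e \<noteq> 0" e0 "\<lambda>e. e v" "Suc D"] insert.prems(4)
    by (auto simp: less_Suc_eq_le)
  define K where "K = e1 v"
  define pK where "pK = (\<lambda>e. if e v = 0 then p (e(v := K)) else 0)"
  have pK_e1: "pK (e1(v := 0)) \<noteq> 0" using e1 by (simp add: pK_def K_def)
  have sum_upd: "sum (e(v := K)) UNIV = sum e UNIV + K" if "e v = 0" for e :: "'n \<Rightarrow> nat"
    using that sum.remove[of UNIV v "e(v := K)"] sum.remove[of UNIV v e] by simp
  have "sum (e1(v := 0, v := K)) UNIV \<le> D" using insert.prems(2)[OF e1(1)] by (simp add: K_def)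
  then have "K \<le> D" by (subst (asm) sum_upd) auto
  \<comment> \<open>Dropping the factor \<open>v^K\<close> lowers the degree bound \<open>D\<close>
    by \<open>K\<close>, while \<open>d\<close>, on which \<open>vanish_order\<close> depends, stays
    fixed.\<close>
  have IH: "CARD('a) * (\<Sum>x\<in>UNIV. vanish_order d pK x) \<le> (D - K) * CARD('a) ^ CARD('n)"
  proof (rule insert.IH)
    fix e i assume "pK e \<noteq> 0" "i \<notin> V"
    then show "e i = 0"
      using insert.prems(1)[of "e(v := K)" i]
      by (cases "i = v") (auto simp: pK_def simp flip: fun_upd_def split: if_splits)
  next
    fix e assume "pK e \<noteq> 0"
    then show "sum e UNIV \<le> D - K"
      using insert.prems(2)[of "e(v := K)"] sum_upd[of e]
      by (auto simp: pK_def simp del: fun_upd_apply split: if_splits)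
  qed (use insert.prems pK_e1 in auto)
  have "CARD('a) * (\<Sum>x\<in>UNIV. vanish_order d p x) = (\<Sum>x\<in>UNIV. \<Sum>t\<in>UNIV. vanish_order d p (x(v := t)))"
    by (rule sum_fun_upd_UNIV[symmetric])
  also have "\<dots> \<le> (\<Sum>x\<in>(UNIV :: ('n \<Rightarrow> 'a) set). CARD('a) * vanish_order d pK x + K)"
  proof (intro sum_mono vanish_order_fiber_le[OF _ _ pK_def pK_e1])
    show "e \<in> exps d" if "p e \<noteq> 0" for e
      using insert.prems(2)[OF that] insert.prems(3) by (simp add: exps_def)
  qed (use e1 in \<open>auto simp: K_def\<close>)
  also have "\<dots> = CARD('a) * (\<Sum>x\<in>UNIV. vanish_order d pK x) + K * CARD('a) ^ CARD('n)"
    by (simp add: sum.distrib sum_distrib_left card_fun)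
  also have "\<dots> \<le> (D - K) * CARD('a) ^ CARD('n) + K * CARD('a) ^ CARD('n)"
    using IH by simp
  also have "\<dots> = D * CARD('a) ^ CARD('n)"
    using \<open>K \<le> D\<close> by (simp flip: add_mult_distrib)
  finally show ?case .
qed

lemma schwartz_zippel_vanish_order:
  fixes p :: "('n::finite \<Rightarrow> nat) \<Rightarrow> 'a::{field,finite}"
  assumes "\<And>e. p e \<noteq> 0 \<Longrightarrow> e \<in> exps d" and "p e0 \<noteq> 0"
  shows "CARD('a) * (\<Sum>x\<in>UNIV. vanish_order d p x) \<le> d * CARD('a) ^ CARD('n)"
  using assms by (intro schwartz_zippel_vanish_order_aux[of UNIV _ _ _ e0]) (auto simp: exps_def less_Suc_eq_le)

section \<open>Interpolation with multiplicities\<close>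

text \<open>
  Writing exponents as \<open>r j + \<rho>\<close> with \<open>\<rho> < r\<close> compares the two counts without binomial estimates.
\<close>

lemma power_mult_card_exps_le:
  "r ^ CARD('n) * card (exps m :: ('n::finite \<Rightarrow> nat) set) \<le>
    card (exps (r * (m + CARD('n))) :: ('n \<Rightarrow> nat) set)"
proof -
  let ?R = "UNIV \<rightarrow>\<^sub>E {..<r} :: ('n \<Rightarrow> nat) set"
  let ?E = "exps m :: ('n \<Rightarrow> nat) set"
  let ?f = "\<lambda>(\<rho>, j) i. r * j i + \<rho> i :: nat"
  have "inj_on ?f (?R \<times> ?E)"
  proof (rule inj_onI, clarify)
    fix \<rho> j \<rho>' j' :: "'n \<Rightarrow> nat"
    assume \<rho>: "\<rho> \<in> ?R" "\<rho>' \<in> ?R" and eq: "(\<lambda>i. r * j i + \<rho> i) = (\<lambda>i. r * j' i + \<rho>' i)"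
    have "\<rho> i = \<rho>' i \<and> j i = j' i" for i
    proof -
      have lt: "\<rho> i < r" "\<rho>' i < r" using \<rho> by auto
      have e: "r * j i + \<rho> i = r * j' i + \<rho>' i" using eq by metis
      have "\<rho> i = (r * j i + \<rho> i) mod r" "\<rho>' i = (r * j' i + \<rho>' i) mod r"
        "j i = (r * j i + \<rho> i) div r" "j' i = (r * j' i + \<rho>' i) div r"
        using lt by simp_all
      then show ?thesis using e by metis
    qed
    then show "\<rho> = \<rho>' \<and> j = j'" by auto
  qed
  then have "r ^ CARD('n) * card ?E = card (?f ` (?R \<times> ?E))"
    by (simp add: card_image card_cartesian_product card_funcsetE)
  also have "\<dots> \<le> card (exps (r * (m + CARD('n))) :: ('n \<Rightarrow> nat) set)"
  proof (rule card_mono)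
    show "?f ` (?R \<times> ?E) \<subseteq> exps (r * (m + CARD('n)))"
    proof clarify
      fix \<rho> j :: "'n \<Rightarrow> nat" assume \<rho>: "\<rho> \<in> ?R" and j: "j \<in> ?E"
      \<comment> \<open>The remainders add at most \<open>r * CARD('n)\<close> to the degree, whence
        \<open>m + CARD('n)\<close> in place of \<open>m\<close>.\<close>
      have "\<rho> i \<le> r" for i using \<rho> by (auto intro: less_imp_le)
      then have "sum \<rho> UNIV \<le> r * CARD('n)"
        using sum_bounded_above[of UNIV \<rho> r] by (simp add: mult.commute)
      moreover have "r * sum j UNIV \<le> r * m"
        using j unfolding exps_def by (intro mult_le_mono2) simp
      ultimately have "sum \<rho> UNIV + r * sum j UNIV \<le> r * CARD('n) + r * m" by (rule add_mono)
      then show "(\<lambda>i. r * j i + \<rho> i) \<in> exps (r * (m + CARD('n)))"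
        by (simp add: exps_def sum.distrib sum_distrib_left[symmetric] add_mult_distrib2 add.commute)
    qed
  qed simp
  finally show ?thesis .
qed

lemma hasse_diff: "hasse d (\<lambda>e. p e - p' e) j x = hasse d p j x - hasse d p' j x"
  by (simp add: hasse_def sum_subtractf left_diff_distrib)

lemma hasse_cong: "(\<And>e. e \<in> exps d \<Longrightarrow> p e = p' e) \<Longrightarrow> hasse d p j x = hasse d p' j x"
  by (simp add: hasse_def)

text \<open>Pigeonhole: there are more coefficient vectors than tables of derivative values on
  \<open>S\<close>, so two distinct polynomials share a table, and their difference is the
  polynomial sought.\<close>

lemma ex_vanishing_polynomial:
  fixes S :: "('n::finite \<Rightarrow> 'a::{field,finite}) set"
  assumes S: "card S < r ^ CARD('n)" and d: "d = r * (m + CARD('n))"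
  obtains p :: "('n \<Rightarrow> nat) \<Rightarrow> 'a" and e0 where "p e0 \<noteq> 0"
    and "\<And>e. p e \<noteq> 0 \<Longrightarrow> e \<in> exps d"
    and "\<And>a j. a \<in> S \<Longrightarrow> j \<in> exps m \<Longrightarrow> hasse d p j a = 0"
proof -
  let ?E = "exps d :: ('n \<Rightarrow> nat) set" and ?J = "exps m :: ('n \<Rightarrow> nat) set"
  let ?P = "?E \<rightarrow>\<^sub>E (UNIV :: 'a set)"
  let ?Q = "S \<times> ?J \<rightarrow>\<^sub>E (UNIV :: 'a set)"
  let ?F = "\<lambda>p. restrict (\<lambda>(a, j). hasse d p j a) (S \<times> ?J)"
  have "(\<lambda>_. 0) \<in> ?J" by (simp add: exps_def)
  then have "card ?J > 0" by (auto simp: card_gt_0_iff)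
  then have "card (S \<times> ?J) < r ^ CARD('n) * card ?J"
    using S by (simp add: card_cartesian_product)
  also have "\<dots> \<le> card ?E"
    unfolding d by (rule power_mult_card_exps_le)
  finally have less: "card (S \<times> ?J) < card ?E" .
  have "card {0, 1 :: 'a} \<le> CARD('a)" by (intro card_mono) auto
  then have "CARD('a) > 1" by simp
  then have "card ?Q < card ?P"
    using less by (simp add: card_funcsetE del: card_cartesian_product)
  moreover have "?F ` ?P \<subseteq> ?Q" by (intro image_subsetI restrict_PiE_iff[THEN iffD2]) simp
  moreover have "finite ?Q" by (intro finite_PiE) auto
  ultimately have "\<not> inj_on ?F ?P"
    by (metis card_inj_on_le not_less)
  then obtain p1 p2 where p: "p1 \<in> ?P" "p2 \<in> ?P" "?F p1 = ?F p2" "p1 \<noteq> p2"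
    by (auto simp: inj_on_def)
  define p where "p = (\<lambda>e. if e \<in> ?E then p1 e - p2 e else 0)"
  obtain e0 where "e0 \<in> ?E" "p1 e0 \<noteq> p2 e0"
    using p by (metis PiE_ext)
  then have "p e0 \<noteq> 0" by (simp add: p_def)
  moreover have "e \<in> exps d" if "p e \<noteq> 0" for e
    using that by (auto simp: p_def split: if_splits)
  moreover have "hasse d p j a = 0" if "a \<in> S" "j \<in> exps m" for a j
  proof -
    have "hasse d p j a = hasse d (\<lambda>e. p1 e - p2 e) j a"
      by (rule hasse_cong) (simp add: p_def)
    also have "\<dots> = ?F p1 (a, j) - ?F p2 (a, j)"
      using that by (simp add: hasse_diff)
    finally show ?thesis by (simp add: p(3))
  qed
  ultimately show thesis by (rule that)
qed

section \<open>Incidences between curves and a small set\<close>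

lemma degree_hasse_le:
  fixes p :: "('n::finite \<Rightarrow> nat) \<Rightarrow> 'a::field"
  assumes "\<And>i. degree (h i) \<le> L"
  shows "degree (hasse d (\<lambda>e. [:p e:]) j h) \<le> d * L"
  unfolding hasse_def
proof (rule degree_sum_le)
  fix e :: "'n \<Rightarrow> nat" assume e: "e \<in> exps d"
  have "degree (hasse_monom (e i) (j i) (h i)) \<le> e i * L" for i
  proof -
    have "degree (hasse_monom (e i) (j i) (h i)) \<le> degree (h i ^ (e i - j i))"
      unfolding hasse_monom_def by (rule order_trans[OF degree_mult_le]) simp
    also have "\<dots> \<le> degree (h i) * (e i - j i)" by (rule degree_power_le)
    also have "\<dots> \<le> L * e i" using assms by (intro mult_mono) auto
    finally show ?thesis by (simp add: mult.commute)
  qed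
  then have "degree (\<Prod>i\<in>UNIV. hasse_monom (e i) (j i) (h i)) \<le> (\<Sum>i\<in>UNIV. e i * L)"
    by (intro order_trans[OF degree_prod_sum_le] sum_mono) auto
  also have "\<dots> \<le> d * L"
    using e by (simp add: exps_def flip: sum_distrib_right)
  finally have "degree (\<Prod>i\<in>UNIV. hasse_monom (e i) (j i) (h i)) \<le> d * L" .
  then show "degree ([:p e:] * (\<Prod>i\<in>UNIV. hasse_monom (e i) (j i) (h i))) \<le> d * L"
    by (intro order_trans[OF degree_mult_le]) simp
qed simp

lemma sum_incidences_le:
  fixes S :: "('n::finite \<Rightarrow> 'a::{field,finite}) set"
    and h :: "('n \<Rightarrow> 'a) \<Rightarrow> 'n \<Rightarrow> 'a poly"
  assumes deg: "\<And>x i. degree (h x i) \<le> L"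
    and base: "\<And>x i. poly (h x i) t0 = x i"
    and S: "card S < r ^ CARD('n)"
  shows "(\<Sum>x\<in>UNIV. card {u. (\<lambda>i. poly (h x i) u) \<in> S}) \<le> (L + 1) * r * CARD('a) ^ CARD('n)"
    (is "?G \<le> ?X")
proof -
  have bound: "m * ?G \<le> (m + CARD('n)) * ?X" for m
  proof -
    define d where "d = r * (m + CARD('n))"
    obtain p e0 where p: "p e0 \<noteq> 0" "\<And>e. p e \<noteq> 0 \<Longrightarrow> e \<in> exps d"
      and van: "\<And>a j. a \<in> S \<Longrightarrow> j \<in> exps m \<Longrightarrow> hasse d p j a = 0"
      using ex_vanishing_polynomial[OF S d_def] by blast
    have "m * card {u. (\<lambda>i. poly (h x i) u) \<in> S} \<le> d * L + CARD('a) * vanish_order d p x" for x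
    proof -
      let ?U = "{u. (\<lambda>i. poly (h x i) u) \<in> S}" and ?\<mu> = "vanish_order d p x"
      obtain j where j: "sum j UNIV = ?\<mu>" "hasse d p j x \<noteq> 0"
        using ex_hasse_vanish_order_nonzero[of p e0 d x] p by blast
      define g where "g = hasse d (\<lambda>e. [:p e:]) j (h x)"
      \<comment> \<open>The curve is at \<open>x\<close> for the parameter \<open>t0\<close>, where
        this derivative was chosen not to vanish.\<close>
      have "poly g t0 \<noteq> 0" using j(2) by (simp add: g_def poly_hasse base)
      then have "g \<noteq> 0" by auto
      have "card ?U * (m - ?\<mu>) = (\<Sum>u\<in>UNIV. if u \<in> ?U then m - ?\<mu> else 0)"
        by (simp add: sum.If_cases)
      also have "\<dots> \<le> degree g"
      proof (rule sum_root_multiplicities_le_degree[OF \<open>g \<noteq> 0\<close>])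
        fix u
        have "[:- u, 1:] ^ (m - sum j UNIV) dvd g" if "u \<in> ?U"
          unfolding g_def by (intro linear_power_dvd_hasse van) (use that in \<open>auto simp: exps_def\<close>)
        then show "[:- u, 1:] ^ (if u \<in> ?U then m - ?\<mu> else 0) dvd g"
          by (simp add: j(1))
      qed
      also have "\<dots> \<le> d * L" unfolding g_def by (rule degree_hasse_le[OF deg])
      finally have le: "card ?U * (m - ?\<mu>) \<le> d * L" .
      \<comment> \<open>This also covers \<open>?\<mu> > m\<close>, where the truncated difference
        is \<open>0\<close>.\<close>
      have "m * card ?U \<le> (m - ?\<mu> + ?\<mu>) * card ?U" by (intro mult_right_mono) auto
      also have "\<dots> = card ?U * (m - ?\<mu>) + card ?U * ?\<mu>" by (simp add: algebra_simps)
      also have "\<dots> \<le> d * L + CARD('a) * ?\<mu>"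
        using le by (intro add_mono mult_right_mono card_mono) auto
      finally show ?thesis .
    qed
    then have "m * ?G \<le> (\<Sum>x\<in>(UNIV :: ('n \<Rightarrow> 'a) set). d * L + CARD('a) * vanish_order d p x)"
      unfolding sum_distrib_left by (intro sum_mono)
    also have "\<dots> = CARD('a) ^ CARD('n) * (d * L) + CARD('a) * (\<Sum>x\<in>UNIV. vanish_order d p x)"
      by (simp add: sum.distrib sum_distrib_left card_fun)
    also have "\<dots> \<le> CARD('a) ^ CARD('n) * (d * L) + d * CARD('a) ^ CARD('n)"
      using schwartz_zippel_vanish_order[of p d e0] p by simp
    also have "\<dots> = (m + CARD('n)) * ?X" by (simp add: d_def algebra_simps)
    finally show ?thesis .
  qed
  show ?thesis
  proof (rule ccontr)
    assume "\<not> ?thesis"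
    then have "Suc ?X \<le> ?G" by simp
    \<comment> \<open>Instead of letting \<open>m\<close> tend to infinity, integrality is used: if
      \<open>?G \<ge> ?X + 1\<close>, then \<open>bound\<close> forces
      \<open>m \<le> CARD('n) * ?X\<close>.\<close>
    define m where "m = CARD('n) * ?X + 1"
    have "m * Suc ?X \<le> m * ?G" using \<open>Suc ?X \<le> ?G\<close> by (rule mult_le_mono2)
    also have "\<dots> \<le> (m + CARD('n)) * ?X" by (rule bound)
    finally have "m \<le> CARD('n) * ?X" by (simp only: mult_Suc_right add_mult_distrib add_le_cancel_right)
    then show False by (simp add: m_def)
  qed
qed

section \<open>Min-entropy from a bound on the excess mass\<close>

text \<open>
  The witness cuts the mass function off at \<open>K\<close> and spreads the excess proportionally over the room
  left below \<open>K\<close>; if there is no room, the excess is \<open>0\<close> and so is the junk ratio \<open>0 / 0\<close>.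
\<close>

lemma close_to_min_entropyI:
  fixes X :: "'b::finite pmf"
  assumes K: "K > 0" "K * real CARD('b) \<ge> 1"
    and excess: "(\<Sum>x\<in>UNIV. max 0 (pmf X x - K)) \<le> \<epsilon>"
  shows "close_to_min_entropy \<epsilon> X (log 2 (1 / K))"
proof -
  define b where "b x = min (pmf X x) K" for x
  define exc where "exc = (\<Sum>x\<in>UNIV. pmf X x - b x)"
  define gap where "gap = (\<Sum>x\<in>UNIV. K - b x)"
  define z where "z x = b x + exc / gap * (K - b x)" for x
  have b: "0 \<le> b x" "b x \<le> K" "b x \<le> pmf X x" for x
    using K by (auto simp: b_def)
  have total: "(\<Sum>x\<in>UNIV. pmf X x) = 1" by (rule sum_pmf_eq_1) auto
  have exc0: "exc \<ge> 0" unfolding exc_def using b by (intro sum_nonneg) auto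
  have exc_le: "exc \<le> \<epsilon>"
    using excess unfolding exc_def b_def
    by (rule order_trans[rotated]) (intro sum_mono, auto)
  \<comment> \<open>The difference \<open>gap - exc\<close> is
    \<open>K * CARD('b) - 1\<close>.\<close>
  have le: "exc \<le> gap"
    using K total by (simp add: exc_def gap_def sum_subtractf mult.commute)
  then have ratio: "0 \<le> exc / gap" "exc / gap \<le> 1"
    using exc0 by (auto simp: divide_le_eq_1)
  have z: "b x \<le> z x" "z x \<le> K" for x
  proof -
    show "b x \<le> z x" using mult_nonneg_nonneg[OF ratio(1), of "K - b x"] b by (simp add: z_def)
    have "exc / gap * (K - b x) \<le> 1 * (K - b x)"
      using b ratio by (intro mult_right_mono) auto
    then show "z x \<le> K" by (simp add: z_def)
  qed
  have z0: "0 \<le> z x" for x using z(1) b(1) by (rule order_trans[rotated])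
  have "(\<Sum>x\<in>UNIV. z x) = (\<Sum>x\<in>UNIV. b x) + exc / gap * gap"
    by (simp add: z_def sum.distrib gap_def sum_distrib_left)
  also have "exc / gap * gap = exc" using le exc0 by (cases "gap = 0") auto
  finally have z1: "(\<Sum>x\<in>UNIV. z x) = 1"
    by (simp add: exc_def sum_subtractf total)
  define Z where "Z = embed_pmf z"
  have pmf_Z: "pmf Z x = z x" for x
    unfolding Z_def using z0 z1
    by (intro pmf_embed_pmf) (auto simp: nn_integral_count_space_finite sum_ennreal simp flip: ennreal_1)
  have one_sided: "measure_pmf.prob X T - measure_pmf.prob Z T \<le> \<epsilon>" for T
  proof -
    have "measure_pmf.prob X T - measure_pmf.prob Z T = (\<Sum>x\<in>T. pmf X x - z x)"
      by (simp add: measure_measure_pmf_finite pmf_Z sum_subtractf)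
    also have "\<dots> \<le> (\<Sum>x\<in>T. pmf X x - b x)" using z by (intro sum_mono) auto
    also have "\<dots> \<le> exc" unfolding exc_def using b by (intro sum_mono2) auto
    finally show ?thesis using exc_le by simp
  qed
  \<comment> \<open>Passing to the complement of \<open>T\<close> negates the difference of
    probabilities.\<close>
  have "\<bar>measure_pmf.prob X T - measure_pmf.prob Z T\<bar> \<le> \<epsilon>" for T
    using one_sided[of T] one_sided[of "- T"]
      measure_pmf.prob_compl[of T X] measure_pmf.prob_compl[of T Z]
    by (simp add: Compl_eq_Diff_UNIV)
  then have "eps_close \<epsilon> X Z"
    unfolding eps_close_def stat_dist_def by (subst Max_le_iff) auto
  moreover have "log 2 (1 / K) \<le> min_entropy Z"
  proof -
    have "log 2 (1 / K) \<le> log 2 (1 / pmf Z x)" if "x \<in> set_pmf Z" for x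
    proof -
      have "pmf Z x > 0" using that by (simp add: pmf_positive)
      moreover have "pmf Z x \<le> K" using z by (simp add: pmf_Z)
      ultimately show ?thesis using K by (simp add: frac_le)
    qed
    then show ?thesis
      unfolding min_entropy_def by (subst Min_ge_iff) (auto simp: set_pmf_not_empty)
  qed
  ultimately show ?thesis unfolding close_to_min_entropy_def by blast
qed

section \<open>The merger\<close>

text \<open>The coordinates of \<open>u \<mapsto> f_DW c (Y x, u)\<close> are polynomials of degree
  at most \<open>CARD('l) - 1\<close>, and the curve passes through \<open>x\<close> at
  \<open>\<gamma> i0\<close>, so \<open>sum_incidences_le\<close> applies.\<close>

lemma sum_hits_f_DW_le:
  fixes \<gamma> :: "'l::finite \<Rightarrow> 'a::{field,finite}"
    and Y :: "'a ^ 'n::finite \<Rightarrow> ('a ^ 'n) ^ 'l"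
  assumes c: "is_interp_basis \<gamma> c" and Y: "\<And>x. Y x $ i0 = x"
    and S: "card S < r ^ CARD('n)"
  shows "(\<Sum>x\<in>UNIV. card {u. f_DW c (Y x, u) \<in> S}) \<le> CARD('l) * r * CARD('a) ^ CARD('n)"
proof -
  define h where "h x i = (\<Sum>l\<in>UNIV. smult (Y (vec_lambda x) $ l $ i) (c l))" for x i
  have h: "(\<lambda>i. poly (h x i) u) = vec_nth (f_DW c (Y (vec_lambda x), u))" for x u
    by (auto simp: h_def f_DW_def poly_sum mult.commute)
  have "(\<Sum>x\<in>UNIV. card {u. f_DW c (Y x, u) \<in> S}) =
      (\<Sum>x\<in>UNIV. card {u. f_DW c (Y (vec_lambda x), u) \<in> S})"
    by (rule sum.reindex_bij_witness[of _ vec_lambda vec_nth]) auto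
  also have "\<dots> = (\<Sum>x\<in>UNIV. card {u. (\<lambda>i. poly (h x i) u) \<in> vec_nth ` S})"
    unfolding h by (simp add: inj_image_mem_iff inj_def vec_nth_inject)
  also have "\<dots> \<le> (CARD('l) - 1 + 1) * r * CARD('a) ^ CARD('n)"
  proof (rule sum_incidences_le)
    fix x i
    show "degree (h x i) \<le> CARD('l) - 1"
      unfolding h_def using c
      by (intro degree_sum_le) (auto simp: is_interp_basis_def intro: order_trans[OF degree_smult_le])
    have "poly (h x i) (\<gamma> i0) = (\<Sum>l\<in>UNIV. if l = i0 then Y (vec_lambda x) $ l $ i else 0)"
      unfolding h_def poly_sum using c by (intro sum.cong) (auto simp: is_interp_basis_def)
    then show "poly (h x i) (\<gamma> i0) = x i" by (simp add: Y)
  next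
    show "card (vec_nth ` S) < r ^ CARD('n)"
      using S card_image_le[of S vec_nth] by simp
  qed
  finally show ?thesis by simp
qed

text \<open>The other coordinates may depend arbitrarily on the uniform one. Replacing them by the
  worst completion \<open>Y\<close> leaves an expectation over the uniform coordinate alone.\<close>

lemma expectation_hits_f_DW_le:
  fixes \<gamma> :: "'l::finite \<Rightarrow> 'a::{field,finite}"
    and D :: "(('a ^ 'n::finite) ^ 'l) pmf"
  assumes c: "is_interp_basis \<gamma> c" and D: "has_uniform_coordinate D"
    and S: "card S < r ^ CARD('n)"
  shows "(\<Sum>y\<in>UNIV. pmf D y * real (card {u. f_DW c (y, u) \<in> S})) \<le> real CARD('l) * real r"
proof -
  define \<phi> where "\<phi> y = card {u. f_DW c (y, u) \<in> S}" for y
  obtain i0 where i0: "map_pmf (\<lambda>x. x $ i0) D = pmf_of_set UNIV"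
    using D unfolding has_uniform_coordinate_def by blast
  have "\<exists>y. y $ i0 = x \<and> (\<forall>y'. y' $ i0 = x \<longrightarrow> \<phi> y' \<le> \<phi> y)" for x
  proof (rule ex_has_greatest_nat[of _ "\<chi> _. x" _ "Suc CARD('a)"])
    show "\<forall>y. y $ i0 = x \<longrightarrow> \<phi> y < Suc CARD('a)"
      by (auto simp: \<phi>_def less_Suc_eq_le intro: card_mono)
  qed simp
  then obtain Y where Y: "\<And>x. Y x $ i0 = x" "\<And>x y. y $ i0 = x \<Longrightarrow> \<phi> y \<le> \<phi> (Y x)"
    by metis
  have "(\<Sum>y\<in>UNIV. pmf D y * real (\<phi> y)) \<le> (\<Sum>y\<in>UNIV. pmf D y * real (\<phi> (Y (y $ i0))))"
    using Y by (intro sum_mono mult_left_mono) auto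
  also have "\<dots> = measure_pmf.expectation D (\<lambda>y. real (\<phi> (Y (y $ i0))))"
    by (subst integral_measure_pmf_real[of UNIV]) (auto simp: mult.commute)
  also have "\<dots> = measure_pmf.expectation (map_pmf (\<lambda>x. x $ i0) D) (\<lambda>x. real (\<phi> (Y x)))"
    by simp
  also have "\<dots> = (\<Sum>x\<in>UNIV. real (\<phi> (Y x))) / real (CARD('a) ^ CARD('n))"
    unfolding i0 by (subst integral_pmf_of_set) auto
  also have "\<dots> \<le> real (CARD('l) * r * CARD('a) ^ CARD('n)) / real (CARD('a) ^ CARD('n))"
    using sum_hits_f_DW_le[OF c Y(1) S] unfolding \<phi>_def
    by (intro divide_right_mono) (simp_all flip: of_nat_sum of_nat_mult of_nat_power)
  also have "\<dots> = real CARD('l) * real r" by simp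
  finally show ?thesis unfolding \<phi>_def .
qed

text \<open>Given \<open>y\<close>, the probability is the number of hits over
  \<open>CARD('a)\<close>. Averaging over \<open>y\<close> is linear in the distribution of
  \<open>A\<close>, so the bound for each component of the mixture suffices.\<close>

lemma prob_f_DW_le:
  fixes \<gamma> :: "'l::finite \<Rightarrow> 'a::{field,finite}"
    and A :: "(('a ^ 'n::finite) ^ 'l) pmf"
  assumes c: "is_interp_basis \<gamma> c" and A: "somewhere_random A"
    and S: "card S < r ^ CARD('n)"
  shows "measure_pmf.prob (map_pmf (f_DW c) (pair_pmf A (pmf_of_set UNIV))) S
    \<le> real CARD('l) * real r / real CARD('a)"
proof -
  let ?\<phi> = "\<lambda>y. real (card {u. f_DW c (y, u) \<in> S})"
  obtain N :: nat and w :: "nat \<Rightarrow> real" and D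
    where w: "\<And>k. k < N \<Longrightarrow> 0 \<le> w k" "(\<Sum>k<N. w k) = 1"
      and D: "\<And>k. k < N \<Longrightarrow> has_uniform_coordinate (D k)"
      and A_eq: "\<And>x. pmf A x = (\<Sum>k<N. w k * pmf (D k) x)"
    using A unfolding somewhere_random_def by blast
  have "measure_pmf.prob (map_pmf (f_DW c) (pair_pmf A (pmf_of_set UNIV))) S =
      (\<Sum>z\<in>f_DW c -` S. pmf (pair_pmf A (pmf_of_set UNIV)) z)"
    by (simp add: measure_measure_pmf_finite)
  also have "f_DW c -` S = (SIGMA y:UNIV. {u. f_DW c (y, u) \<in> S})" by auto
  also have "(\<Sum>z\<in>\<dots>. pmf (pair_pmf A (pmf_of_set UNIV)) z) =
      (\<Sum>(y, u)\<in>(SIGMA y:UNIV. {u. f_DW c (y, u) \<in> S}). pmf A y / real CARD('a))"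
    by (intro sum.cong) (auto simp: pmf_pair)
  also have "\<dots> = (\<Sum>y\<in>UNIV. pmf A y * ?\<phi> y) / real CARD('a)"
    by (subst sum.Sigma[symmetric]) (auto simp: sum_divide_distrib mult.commute)
  also have "(\<Sum>y\<in>UNIV. pmf A y * ?\<phi> y) = (\<Sum>k<N. w k * (\<Sum>y\<in>UNIV. pmf (D k) y * ?\<phi> y))"
    unfolding A_eq sum_distrib_right sum_distrib_left
    by (subst sum.swap) (simp add: mult.assoc)
  also have "\<dots> \<le> (\<Sum>k<N. w k * (real CARD('l) * real r))"
    using w D by (intro sum_mono mult_left_mono expectation_hits_f_DW_le[OF c _ S]) auto
  also have "\<dots> = real CARD('l) * real r"
    using w(2) by (simp flip: sum_distrib_right)
  finally show ?thesis by (simp add: divide_right_mono)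
qed

theorem theorem18:
  fixes \<gamma> :: "'l::finite \<Rightarrow> 'a::{field,finite}"
    and c :: "'l \<Rightarrow> 'a poly"
    and A :: "(('a ^ 'n::finite) ^ 'l) pmf"
    and B :: "'a pmf"
    and C :: "('a ^ 'n) pmf"
    and \<epsilon> \<delta> :: real
  assumes "CARD('a) \<ge> CARD('l)"
    and "\<epsilon> > 0" and "\<delta> > 0"
    and "inj \<gamma>"
    and "is_interp_basis \<gamma> c"
    and "somewhere_random A"
    and "B = pmf_of_set UNIV"
    and "C = map_pmf (f_DW c) (pair_pmf A B)"
    and "real CARD('a) \<ge> (2 * real CARD('l) / \<epsilon>) powr (1 / \<delta>)"
  shows "close_to_min_entropy \<epsilon> C ((1 - \<delta>) * real CARD('n) * log 2 (real CARD('a)))"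
proof -
  define q where "q = real CARD('a)"
  define d where "d = q powr (1 - \<delta>)"
  \<comment> \<open>Masses at most \<open>K\<close> are exactly what the target min-entropy demands;
    see \<open>log_K\<close>.\<close>
  define K where "K = 1 / d ^ CARD('n)"
  have q: "q \<ge> 1" unfolding q_def using zero_less_card_finite[where 'a = 'a] by linarith
  have d: "d > 0" using q by (simp add: d_def)
  have K: "K > 0" using d by (simp add: K_def)
  have d_pow: "d ^ CARD('n) = q powr ((1 - \<delta>) * real CARD('n))"
    using q by (simp add: d_def powr_realpow[symmetric] powr_powr)
  have "d \<le> q powr 1"
    unfolding d_def using q assms(3) by (intro powr_mono) auto
  then have "d ^ CARD('n) \<le> q ^ CARD('n)"
    using d q by (intro power_mono) auto
  then have K1: "K * real CARD('a ^ 'n) \<ge> 1"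
    using d by (simp add: K_def q_def)
  have log_K: "log 2 (1 / K) = (1 - \<delta>) * real CARD('n) * log 2 q"
    using q by (simp add: K_def d_pow log_powr)
  \<comment> \<open>The hypothesis on \<open>q\<close> is raised to the power
    \<open>\<delta>\<close>, to meet \<open>d / q = 1 / q powr \<delta>\<close> at the end.\<close>
  have "(2 * real CARD('l) / \<epsilon>) = ((2 * real CARD('l) / \<epsilon>) powr (1 / \<delta>)) powr \<delta>"
    using assms(2,3) by (simp add: powr_powr)
  also have "\<dots> \<le> q powr \<delta>"
    using assms(3,9) by (intro powr_mono2) (auto simp: q_def)
  finally have q_\<delta>: "2 * real CARD('l) \<le> \<epsilon> * q powr \<delta>"
    using assms(2) by (simp add: field_simps)
  define S where "S = {x. pmf C x > K}"
  have "(\<Sum>x\<in>UNIV. max 0 (pmf C x - K)) = (\<Sum>x\<in>S. pmf C x - K)"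
    by (rule sum.mono_neutral_cong_right) (auto simp: S_def)
  also have "\<dots> = measure_pmf.prob C S - K * real (card S)"
    by (simp add: measure_measure_pmf_finite sum_subtractf)
  finally have excess: "(\<Sum>x\<in>UNIV. max 0 (pmf C x - K)) = measure_pmf.prob C S - K * real (card S)" .
  have "measure_pmf.prob C S \<le> \<epsilon>"
  proof (cases "S = {}")
    case True
    then show ?thesis using assms(2) by simp
  next
    case False
    have "K * real (card S) = (\<Sum>x\<in>S. K)" by simp
    also have "\<dots> < (\<Sum>x\<in>S. pmf C x)"
      using False by (intro sum_strict_mono) (auto simp: S_def)
    also have "\<dots> = measure_pmf.prob C S" by (simp add: measure_measure_pmf_finite)
    also have "\<dots> \<le> 1" by simp
    finally have card_S: "real (card S) < d ^ CARD('n)"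
      using d by (simp add: K_def field_simps)
    \<comment> \<open>Needed for the ceiling of \<open>d\<close> to be at most \<open>2 * d\<close>.
      If \<open>d \<le> 1\<close>, the bound \<open>card_S\<close> would leave \<open>S\<close>
      empty.\<close>
    have "d > 1"
    proof (rule ccontr)
      assume "\<not> d > 1"
      then have "d ^ CARD('n) \<le> 1" using d by (intro power_le_one) auto
      moreover have "card S \<ge> 1" using False by (simp add: Suc_le_eq card_gt_0_iff)
      ultimately show False using card_S by linarith
    qed
    define r where "r = nat \<lceil>d\<rceil>"
    have r: "d \<le> real r" "real r \<le> 2 * d"
      using \<open>d > 1\<close> unfolding r_def by linarith+
    have "d ^ CARD('n) \<le> real r ^ CARD('n)" using d r by (intro power_mono) auto
    then have "real (card S) < real (r ^ CARD('n))"
      unfolding of_nat_power by (rule less_le_trans[OF card_S])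
    then have "card S < r ^ CARD('n)" by (simp only: of_nat_less_iff)
    then have "measure_pmf.prob C S \<le> real CARD('l) * real r / q"
      using prob_f_DW_le[OF assms(5,6)] by (simp add: assms(7,8) q_def)
    also have "\<dots> \<le> real CARD('l) * (2 * d) / q"
      using r q by (intro divide_right_mono mult_left_mono) auto
    also have "\<dots> = 2 * real CARD('l) / q powr \<delta>"
      using q by (simp add: d_def powr_diff)
    also have "\<dots> \<le> \<epsilon>"
      using q_\<delta> q by (simp add: divide_le_eq)
    finally show ?thesis .
  qed
  moreover have "0 \<le> K * real (card S)" using K by simp
  ultimately have "(\<Sum>x\<in>UNIV. max 0 (pmf C x - K)) \<le> \<epsilon>" unfolding excess by linarith
  then have "close_to_min_entropy \<epsilon> C (log 2 (1 / K))"
    using K K1 by (intro close_to_min_entropyI)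
  then show ?thesis by (simp add: log_K q_def)
qed

end
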